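(* Let $q$ be a prime power, let $\ell, N$ be positive integers, and let $n = \ell N$ be a sum-rank length partition with equal sublengths $N = n_1 = n_2 = \cdots = n_\ell$ (extension degree $m=1$). Let $\mathcal{C} \subseteq \mathbb{F}_q^n$ be a linear code and put $r = n - \dim(\mathcal{C})$. Then $\mathcal{C}$ is a proper sum-rank Hamming code if, and only if, $N \leq r$ and $\mathcal{C}$ has a parity-check matrix of the form $$ H = (H_1, H_2, \ldots, H_\ell) \in \mathbb{F}_q^{r \times n}, $$ where $H_i \in \mathbb{F}_q^{r \times N}$ and $\mathcal{H}_i = \mathrm{Col}(H_i) \subseteq \mathbb{F}_q^r$ for $i = 1,2,\ldots,\ell$, and $\mathcal{P} = \{\mathcal{H}_1, \mathcal{H}_2, \ldots, \mathcal{H}_\ell\}$ is a maximal-size partial $N$-spread in $\mathbb{F}_q^r$ (consisting of $\ell$ subspaces).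
   Context: Sum-rank metric for $m=1$: for $\mathbf{c} = (\mathbf{c}^{(1)}, \ldots, \mathbf{c}^{(\ell)}) \in \mathbb{F}_q^n$ with $\mathbf{c}^{(i)} \in \mathbb{F}_q^{N}$, the sum-rank weight is $\mathrm{wt}_{SR}(\mathbf{c}) = \sum_{i=1}^\ell \mathrm{Rk}(\mathbf{c}^{(i)})$, where $\mathbf{c}^{(i)}$ is viewed as a $1\times N$ matrix over $\mathbb{F}_q$ (so the weight is the number of nonzero blocks). For a linear code (subspace) $\mathcal{C}$, $\mathrm{d}_{SR}(\mathcal{C}) = \min\{\mathrm{wt}_{SR}(\mathbf{c}) \mid \mathbf{c} \in \mathcal{C}\setminus\{\mathbf{0}\}\}$, with the convention $\mathrm{d}_{SR}(\{\mathbf{0}\}) = \infty$. Proper sum-rank Hamming code ($m=1$): a linear code $\mathcal{C} \subseteq \mathbb{F}_q^n$, $n = \ell N$, of redundancy $r = n - \dim(\mathcal{C})$, is a proper sum-rank Hamming code if $\mathrm{d}_{SR}(\mathcal{C}) \geq 3$ and there is no linear code $\mathcal{C}' \subseteq \mathbb{F}_q^{n'}$ with $\mathrm{d}_{SR}(\mathcal{C}') \geq 3$ and $n' - \dim(\mathcal{C}') = r$ for a partition $n' = \ell' N$ into $\ell'$ blocks of the same length $N$ with $\ell' > \ell$. A parity-check matrix of a linear code $\mathcal{C}\subseteq\mathbb{F}_q^n$ of redundancy $r$ is a matrix $H \in \mathbb{F}_q^{r\times n}$ of rank $r$ with $\mathcal{C} = \{\mathbf{c} \mid H\mathbf{c}^T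 = \mathbf{0}\}$. $\mathrm{Col}(X)$ is the space spanned by the columns of $X$. Partial spreads: for $1 \leq N \leq r$, a partial $N$-spread in $\mathbb{F}_q^r$ is a family $\{\mathcal{H}_i\}_{i\in I}$ of $N$-dimensional subspaces of $\mathbb{F}_q^r$ with $\mathcal{H}_i \cap \mathcal{H}_j = \{\mathbf{0}\}$ whenever $i \neq j$. It is maximal-size if $|I|$ is the largest possible among all partial $N$-spreads in $\mathbb{F}_q^r$. *)

theory Defs
  imports "Jordan_Normal_Form.DL_Rank" "Jordan_Normal_Form.Matrix_Kernel"
    "HOL-Library.Extended_Nat"
begin

text \<open>
  The field with $q$ elements is a type of sort \<open>{field, finite}\<close>.
  A vector of length \<open>ell * N\<close> is split into \<open>ell\<close> consecutive blocks of length \<open>N\<close>,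
  with blocks and entries counted from 0.
\<close>

definition vec_subspace :: "nat \<Rightarrow> 'a :: field vec set \<Rightarrow> bool" where
  "vec_subspace n W \<longleftrightarrow> VectorSpace.subspace class_ring W (module_vec TYPE('a) n)"

definition vec_subspace_dim :: "nat \<Rightarrow> 'a :: field vec set \<Rightarrow> nat" where
  "vec_subspace_dim n W = vectorspace.dim class_ring ((module_vec TYPE('a) n)\<lparr>carrier := W\<rparr>)"

abbreviation linear_code :: "nat \<Rightarrow> 'a :: {field, finite} vec set \<Rightarrow> bool" where
  "linear_code \<equiv> vec_subspace"

definition redundancy :: "nat \<Rightarrow> 'a :: {field, finite} vec set \<Rightarrow> nat" where
  "redundancy n C = n - vec_subspace_dim n C"

definition vec_block :: "nat \<Rightarrow> 'a vec \<Rightarrow> nat \<Rightarrow> 'a vec" where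
  "vec_block N c i = vec N (\<lambda>j. c $ (i * N + j))"

definition sum_rank_weight :: "nat \<Rightarrow> nat \<Rightarrow> 'a :: {field, finite} vec \<Rightarrow> nat" where
  "sum_rank_weight ell N c = (\<Sum>i<ell. vec_space.rank 1 (mat_of_row (vec_block N c i)))"

text \<open>In \<open>enat\<close> the infimum of a nonempty set is its minimum, and that of the empty set is
  \<open>\<infinity>\<close>, which is the convention for the zero code.\<close>

definition sum_rank_distance :: "nat \<Rightarrow> nat \<Rightarrow> 'a :: {field, finite} vec set \<Rightarrow> enat" where
  "sum_rank_distance ell N C = (INF c \<in> C - {0\<^sub>v (ell * N)}. enat (sum_rank_weight ell N c))"

definition proper_sum_rank_Hamming_code ::
    "nat \<Rightarrow> nat \<Rightarrow> 'a :: {field, finite} vec set \<Rightarrow> bool" where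
  "proper_sum_rank_Hamming_code ell N C \<longleftrightarrow>
     linear_code (ell * N) C \<and> sum_rank_distance ell N C \<ge> 3 \<and>
     \<not> (\<exists>ell' (C' :: 'a vec set). ell' > ell \<and> linear_code (ell' * N) C' \<and>
          sum_rank_distance ell' N C' \<ge> 3 \<and>
          redundancy (ell' * N) C' = redundancy (ell * N) C)"

text \<open>Here \<open>mat_kernel H\<close> is the set of all \<open>c\<close> of length \<open>dim_col H\<close> with \<open>H *\<^sub>v c = 0\<close>.\<close>

definition parity_check_matrix :: "nat \<Rightarrow> 'a :: {field, finite} mat \<Rightarrow> 'a vec set \<Rightarrow> bool" where
  "parity_check_matrix n H C \<longleftrightarrow>
     H \<in> carrier_mat (redundancy n C) n \<and>
     vec_space.rank (redundancy n C) H = redundancy n C \<and>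
     C = mat_kernel H"

definition mat_col_block :: "nat \<Rightarrow> 'a mat \<Rightarrow> nat \<Rightarrow> 'a mat" where
  "mat_col_block N H i = mat (dim_row H) N (\<lambda>(a, j). H $$ (a, i * N + j))"

text \<open>A partial spread is represented by its set of members. For \<open>N \<ge> 1\<close> this is the same as
  an indexed family, since members with distinct indices meet trivially and are therefore distinct.\<close>

definition partial_spread :: "nat \<Rightarrow> nat \<Rightarrow> 'a :: {field, finite} vec set set \<Rightarrow> bool" where
  "partial_spread N r P \<longleftrightarrow>
     (\<forall>U\<in>P. vec_subspace r U \<and> vec_subspace_dim r U = N) \<and>
     (\<forall>U\<in>P. \<forall>W\<in>P. U \<noteq> W \<longrightarrow> U \<inter> W = {0\<^sub>v r})"

text \<open>All partial spreads are finite because the field is, so \<open>card\<close> is the true size.\<close>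

definition maximal_size_partial_spread ::
    "nat \<Rightarrow> nat \<Rightarrow> 'a :: {field, finite} vec set set \<Rightarrow> bool" where
  "maximal_size_partial_spread N r P \<longleftrightarrow>
     partial_spread N r P \<and>
     (\<forall>Q :: 'a vec set set. partial_spread N r Q \<longrightarrow> card Q \<le> card P)"

end

theory Submission
  imports Defs
begin

text \<open>
  A codeword of weight at most 2 lives on at most two blocks, so \<open>H\<^sub>i x + H\<^sub>j y = 0\<close> has a nontrivial
  solution exactly when some block \<open>H\<^sub>i\<close> is not injective or two column spaces meet nontrivially.
  Hence the kernel of \<open>H\<close> has distance at least 3 if and only if the column spaces of the blocks form a
  partial \<open>N\<close>-spread with \<open>ell\<close> members. The two maximality conditions then match: a longer code of
  the same redundancy yields a larger spread through its parity-check matrix, and a larger spread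
  yields a longer code.
\<close>

section \<open>Subspaces and matrices over a field\<close>

lemma vec_subspace_iff:
  "vec_subspace n W \<longleftrightarrow> W \<subseteq> carrier_vec n \<and> 0\<^sub>v n \<in> W \<and>
    (\<forall>v\<in>W. \<forall>w\<in>W. v + w \<in> W) \<and> (\<forall>a. \<forall>v\<in>W. a \<cdot>\<^sub>v v \<in> W)"
  unfolding vec_subspace_def VectorSpace.subspace_def submodule_def
  by (auto simp: vec_vs vec_module module_vec_simps)

lemma vec_subspace_mat_kernel:
  assumes "A \<in> carrier_mat nr nc"
  shows "vec_subspace nc (mat_kernel A)"
  using assms mult_add_distrib_mat_vec[OF assms] mult_mat_vec[OF assms]
  by (auto simp: vec_subspace_iff mat_kernel[OF assms])

lemma col_space_conv_image:
  fixes A :: "'a :: field mat"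
  assumes "A \<in> carrier_mat n nc"
  shows "vec_space.col_space n A = (\<lambda>x. A *\<^sub>v x) ` carrier_vec nc"
  using assms by (auto simp: vec_space.col_space_eq[OF assms])

lemma vec_subspace_col_space:
  fixes A :: "'a :: field mat"
  assumes "A \<in> carrier_mat n nc"
  shows "vec_subspace n (vec_space.col_space n A)"
proof -
  interpret vec_space "TYPE('a)" n .
  have "set (cols A) \<subseteq> carrier_vec n"
    using assms cols_dim by blast
  then show ?thesis
    unfolding vec_subspace_def col_space_def by (simp add: span_is_subspace)
qed

lemma vec_subspace_dim_col_space:
  fixes A :: "'a :: field mat"
  shows "vec_subspace_dim n (vec_space.col_space n A) = vec_space.rank n A"
  by (simp add: vec_subspace_dim_def vec_space.rank_def vec_space.col_space_def)

text \<open>Independent subsets of \<open>W\<close> stay independent in the ambient space, so they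
  have at most \<open>n\<close> elements. One that is maximal exists and generates
  \<open>W\<close>.\<close>

lemma vec_subspace_fin_dim:
  fixes W :: "'a :: field vec set"
  assumes "vec_subspace n W"
  shows "vectorspace.fin_dim class_ring ((module_vec TYPE('a) n)\<lparr>carrier := W\<rparr>)"
proof -
  interpret vec_space "TYPE('a)" n .
  have sub: "submodule class_ring W V"
    using assms by (simp add: vec_subspace_def VectorSpace.subspace_def)
  interpret S: vectorspace class_ring "vs W"
    using subspace_is_vs assms by (simp add: vec_subspace_def)
  have "finite X \<and> card X \<le> n" if "X \<subseteq> W \<and> S.lin_indpt X" for X
    \<comment> \<open>Independence computed inside \<open>W\<close> agrees with independence in the
      whole space, where the dimension \<open>n\<close> bounds it.\<close>
    using that li_le_dim[OF fin_dim, of X] span_li_not_depend[OF _ sub] assms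
    by (auto simp: dim_is_n vec_subspace_iff)
  moreover have "S.lin_indpt {}"
    by (auto simp: S.lin_dep_def)
  ultimately obtain X where "finite X" "maximal X (\<lambda>X. X \<subseteq> W \<and> S.lin_indpt X)"
    using maximal_exists[of "\<lambda>X. X \<subseteq> W \<and> S.lin_indpt X" n "{}"] by auto
  then have "finite X \<and> X \<subseteq> carrier (vs W) \<and> S.gen_set X"
    using S.max_li_is_gen[of X] by (simp add: maximal_def)
  then show ?thesis
    unfolding S.fin_dim_def by blast
qed

lemma vec_subspace_dim_le:
  fixes W :: "'a :: field vec set"
  assumes "vec_subspace n W"
  shows "vec_subspace_dim n W \<le> n"
proof -
  interpret vec_space "TYPE('a)" n .
  show ?thesis
    using subspace_dim[of W] assms vec_subspace_fin_dim[OF assms]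
    unfolding vec_subspace_def vec_subspace_dim_def by (simp add: dim_is_n)
qed

lemma vec_subspace_dim_carrier: "vec_subspace_dim n (carrier_vec n :: 'a :: field vec set) = n"
proof -
  interpret vec_space "TYPE('a)" n .
  have "(module_vec TYPE('a) n)\<lparr>carrier := carrier_vec n\<rparr> = V"
    by (simp add: module_vec_def)
  then show ?thesis
    unfolding vec_subspace_dim_def using dim_is_n by (simp only:)
qed

lemma vec_subspace_dim_zero: "vec_subspace_dim n {0\<^sub>v n :: 'a :: field vec} = 0"
proof -
  interpret vec_space "TYPE('a)" n .
  show ?thesis
    using dim_zero_vs unfolding vec_subspace_dim_def span_empty by simp
qed

text \<open>The columns of \<open>B\<close> are a basis of \<open>W\<close>: independence becomes a
  trivial kernel and generation becomes the equality of the column space with \<open>W\<close>.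
  Dimension arguments thereby turn into matrix arguments.\<close>

lemma vec_subspace_basis_matrix:
  fixes W :: "'a :: field vec set"
  assumes W: "vec_subspace n W"
  obtains B where "B \<in> carrier_mat n (vec_subspace_dim n W)" "mat_kernel B = {0\<^sub>v (vec_subspace_dim n W)}"
    "vec_space.col_space n B = W"
proof -
  interpret vec_space "TYPE('a)" n .
  let ?d = "vec_subspace_dim n W"
  have sub: "submodule class_ring W V"
    using W by (simp add: vec_subspace_def VectorSpace.subspace_def)
  interpret S: vectorspace class_ring "vs W"
    using subspace_is_vs W by (simp add: vec_subspace_def)
  have "S.fin_dim"
    using vec_subspace_fin_dim[OF W] .
  then obtain X where X: "finite X" "S.basis X"
    using S.finite_basis_exists by blast
  then have XW: "X \<subseteq> W" and li: "S.lin_indpt X" and gen: "S.span X = W"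
    by (auto simp: S.basis_def)
  have XV: "X \<subseteq> carrier_vec n"
    using XW W by (auto simp: vec_subspace_iff)
  obtain xs where xs: "set xs = X" "distinct xs"
    using X(1) finite_distinct_list by blast
  have len: "length xs = ?d"
    using S.dim_basis[OF X] xs distinct_card unfolding vec_subspace_dim_def by metis
  define B where "B = mat_of_cols n xs"
  have B: "B \<in> carrier_mat n ?d"
    by (simp add: B_def flip: len)
  have cols: "cols B = xs"
    using XV xs by (simp add: B_def)
  have "lin_indpt X" "span X = W"
    using li gen span_li_not_depend[OF XW sub] by simp_all
  then have "mat_kernel B = {0\<^sub>v ?d}"
    using lin_depI[OF B] xs cols vec_subspace_mat_kernel[OF B]
    by (auto simp: mat_kernel[OF B] vec_subspace_iff)
  moreover have "col_space B = W"
    using \<open>span X = W\<close> by (simp add: col_space_def cols xs)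
  ultimately show thesis
    using that B by blast
qed

section \<open>Rank, nullity and trivial kernels\<close>

lemma rank_nullity_mat:
  fixes A :: "'a :: field mat"
  assumes A: "A \<in> carrier_mat nr nc"
  shows "vec_space.rank nr A + vec_subspace_dim nc (mat_kernel A) = nc"
proof -
  interpret R: vec_space "TYPE('a)" nr .
  interpret C: vec_space "TYPE('a)" nc .
  interpret L: linear_map class_ring C.V R.V "\<lambda>x. A *\<^sub>v x"
    unfolding linear_map_def mod_hom_def mod_hom_axioms_def
    using A mult_add_distrib_mat_vec[OF A] mult_mat_vec[OF A]
    by (auto simp: LinearCombinations.module_hom_def module_vec_simps vec_vs vec_module)
  have "L.imT = R.col_space A" "L.kerT = mat_kernel A"
    unfolding L.im_def L.ker_def
    by (auto simp: col_space_conv_image[OF A] mat_kernel[OF A] module_vec_simps)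
  with L.rank_nullity[OF C.fin_dim] show ?thesis
    by (simp add: R.rank_def R.col_space_def vec_subspace_dim_def C.dim_is_n)
qed

text \<open>In dimension 0 the basis matrix has no columns, and the products it forms are empty
  sums.\<close>

lemma vec_subspace_dim_eq_0_iff:
  fixes W :: "'a :: field vec set"
  assumes W: "vec_subspace n W"
  shows "vec_subspace_dim n W = 0 \<longleftrightarrow> W = {0\<^sub>v n}"
proof
  assume "vec_subspace_dim n W = 0"
  then obtain B where B: "B \<in> carrier_mat n 0" "vec_space.col_space n B = W"
    using vec_subspace_basis_matrix[OF W] by metis
  have "B *\<^sub>v x = 0\<^sub>v n" if "x \<in> carrier_vec 0" for x
    using that B(1) by (intro eq_vecI) (auto simp: scalar_prod_def)
  then have "W \<subseteq> {0\<^sub>v n}"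
    using B(2) by (auto simp: col_space_conv_image[OF B(1)])
  then show "W = {0\<^sub>v n}"
    using W by (auto simp: vec_subspace_iff)
qed (simp add: vec_subspace_dim_zero)

lemma mat_kernel_trivial_iff_rank:
  fixes A :: "'a :: field mat"
  assumes A: "A \<in> carrier_mat nr nc"
  shows "mat_kernel A = {0\<^sub>v nc} \<longleftrightarrow> vec_space.rank nr A = nc"
  using rank_nullity_mat[OF A] vec_subspace_dim_eq_0_iff[OF vec_subspace_mat_kernel[OF A]] by auto

section \<open>Completing bases, parity checks and subspaces of prescribed dimension\<close>

lemma mult_mat_vec_take_cols:
  fixes B :: "'a :: field mat"
  assumes "B \<in> carrier_mat n d" "k \<le> d" "x \<in> carrier_vec k"
  shows "mat n k (\<lambda>(i, j). B $$ (i, j)) *\<^sub>v x = B *\<^sub>v vec d (\<lambda>j. if j < k then x $ j else 0)"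
proof (rule eq_vecI)
  fix i assume "i < dim_vec (B *\<^sub>v vec d (\<lambda>j. if j < k then x $ j else 0))"
  then have i: "i < n"
    using assms by simp
  have "(\<Sum>j = 0..<k. B $$ (i, j) * x $ j) = (\<Sum>j = 0..<d. B $$ (i, j) * (if j < k then x $ j else 0))"
    using assms(2) by (intro sum.mono_neutral_cong_left) auto
  then show "(mat n k (\<lambda>(i, j). B $$ (i, j)) *\<^sub>v x) $ i =
      (B *\<^sub>v vec d (\<lambda>j. if j < k then x $ j else 0)) $ i"
    using i assms by (simp add: scalar_prod_def)
qed (use assms in simp)

text \<open>A kernel vector with nonzero last entry would express \<open>v\<close> through the
  columns of \<open>A\<close>. Hence the last entry vanishes, and the trivial kernel of
  \<open>A\<close> forces the others to vanish too.\<close>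

lemma mat_kernel_append_col:
  fixes A :: "'a :: field mat"
  assumes A: "A \<in> carrier_mat n k" "mat_kernel A = {0\<^sub>v k}"
    and v: "v \<in> carrier_vec n" "v \<notin> vec_space.col_space n A"
  shows "mat_kernel (mat n (Suc k) (\<lambda>(i, j). if j < k then A $$ (i, j) else v $ i)) = {0\<^sub>v (Suc k)}"
    (is "mat_kernel ?B = _")
proof -
  have B: "?B \<in> carrier_mat n (Suc k)"
    by simp
  have "x = 0\<^sub>v (Suc k)" if x: "x \<in> carrier_vec (Suc k)" and Bx: "?B *\<^sub>v x = 0\<^sub>v n" for x
  proof -
    let ?y = "vec k (\<lambda>j. x $ j)"
    have eq: "A *\<^sub>v ?y + x $ k \<cdot>\<^sub>v v = 0\<^sub>v n"
    proof (rule eq_vecI)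
      fix i assume "i < dim_vec (0\<^sub>v n :: 'a vec)"
      then have i: "i < n" by simp
      have "(?B *\<^sub>v x) $ i = 0"
        using i Bx by simp
      then show "(A *\<^sub>v ?y + x $ k \<cdot>\<^sub>v v) $ i = (0\<^sub>v n) $ i"
        using i x A(1) v(1) by (simp add: scalar_prod_def mult.commute)
    qed (use v in simp)
    have "x $ k = 0"
    proof (rule ccontr)
      assume nz: "x $ k \<noteq> 0"
      \<comment> \<open>The coefficients come from solving \<open>eq\<close> for \<open>v\<close>,
        that is, from dividing by \<open>- x $ k\<close>.\<close>
      have "A *\<^sub>v ((- inverse (x $ k)) \<cdot>\<^sub>v ?y) = v"
      proof (rule eq_vecI)
        fix i assume "i < dim_vec v"
        then have i: "i < n" using v by simp
        have "(A *\<^sub>v ?y + x $ k \<cdot>\<^sub>v v) $ i = 0"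
          using eq i by simp
        then have "(A *\<^sub>v ?y) $ i = - (x $ k * v $ i)"
          using i A(1) v(1) by (simp add: eq_neg_iff_add_eq_0)
        moreover have "A *\<^sub>v ((- inverse (x $ k)) \<cdot>\<^sub>v ?y) = (- inverse (x $ k)) \<cdot>\<^sub>v (A *\<^sub>v ?y)"
          by (rule mult_mat_vec[OF A(1)]) simp
        ultimately show "(A *\<^sub>v ((- inverse (x $ k)) \<cdot>\<^sub>v ?y)) $ i = v $ i"
          using i A(1) nz by (simp del: mult_mat_vec index_mult_mat_vec)
      qed (use A v in simp)
      then have "v \<in> vec_space.col_space n A"
        unfolding col_space_conv_image[OF A(1)] by (metis image_eqI smult_carrier_vec vec_carrier)
      with v(2) show False by simp
    qed
    then have "A *\<^sub>v ?y = 0\<^sub>v n"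
      using eq v(1) A(1) vec_subspace_mat_kernel[OF A(1)] by (auto simp: vec_eq_iff)
    then have "?y = 0\<^sub>v k"
      using mat_kernelI[OF A(1), of ?y] A(2) by simp
    then have "x $ j = 0" if "j < k" for j
      using that by (metis index_vec index_zero_vec(1))
    with \<open>x $ k = 0\<close> have "x $ j = 0" if "j < Suc k" for j
      using that less_Suc_eq by auto
    then show ?thesis
      using x by (intro eq_vecI) auto
  qed
  moreover have "0\<^sub>v (Suc k) \<in> mat_kernel ?B"
    using vec_subspace_mat_kernel[OF B] by (simp add: vec_subspace_iff)
  ultimately show ?thesis
    unfolding mat_kernel[OF B] by blast
qed

text \<open>Completion of independent columns one at a time: as long as there are fewer than
  \<open>n\<close> of them, some vector lies outside their span and can be appended.\<close>

lemma mat_kernel_trivial_extend: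
  fixes A :: "'a :: field mat"
  assumes A: "A \<in> carrier_mat n d" "mat_kernel A = {0\<^sub>v d}" and "d \<le> k" "k \<le> n"
  shows "\<exists>E \<in> carrier_mat n k. mat_kernel E = {0\<^sub>v k} \<and> A = mat n d (\<lambda>(i, j). E $$ (i, j))"
  using \<open>d \<le> k\<close> \<open>k \<le> n\<close>
proof (induction k rule: dec_induct)
  case base
  then show ?case
    using A by (intro bexI[of _ A]) auto
next
  case (step k)
  then obtain E where E: "E \<in> carrier_mat n k" "mat_kernel E = {0\<^sub>v k}"
    and AE: "A = mat n d (\<lambda>(i, j). E $$ (i, j))"
    by auto
  have "vec_subspace_dim n (vec_space.col_space n E) \<noteq> n"
    using mat_kernel_trivial_iff_rank[OF E(1)] E(2) step.prems
    by (simp add: vec_subspace_dim_col_space)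
  then have "vec_space.col_space n E \<noteq> carrier_vec n"
    using vec_subspace_dim_carrier by metis
  then obtain v where "v \<in> carrier_vec n" "v \<notin> vec_space.col_space n E"
    using vec_subspace_col_space[OF E(1)] by (auto simp: vec_subspace_iff)
  from mat_kernel_append_col[OF E this] show ?case
    using AE step.hyps
    by (intro bexI[of _ "mat n (Suc k) (\<lambda>(i, j). if j < k then E $$ (i, j) else v $ i)"] conjI)
      (auto intro!: eq_matI)
qed

text \<open>A basis of \<open>C\<close> is completed to an invertible \<open>E\<close>. A vector
  lies in \<open>C\<close> exactly when its coordinates with respect to the columns of
  \<open>E\<close> vanish from position \<open>?d\<close> on, and the inverse of \<open>E\<close>
  computes these coordinates.\<close>

lemma vec_subspace_parity_check:
  fixes C :: "'a :: field vec set"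
  assumes C: "vec_subspace n C"
  shows "\<exists>H \<in> carrier_mat (n - vec_subspace_dim n C) n. mat_kernel H = C"
proof -
  let ?d = "vec_subspace_dim n C"
  have d: "?d \<le> n"
    using vec_subspace_dim_le[OF C] .
  obtain A where A: "A \<in> carrier_mat n ?d" "mat_kernel A = {0\<^sub>v ?d}" "vec_space.col_space n A = C"
    using vec_subspace_basis_matrix[OF C] .
  note C_image = col_space_conv_image[OF A(1), unfolded A(3)]
  obtain E where E: "E \<in> carrier_mat n n" "mat_kernel E = {0\<^sub>v n}"
    and AE: "A = mat n ?d (\<lambda>(i, j). E $$ (i, j))"
    using mat_kernel_trivial_extend[OF A(1,2) d] by blast
  have "det E \<noteq> 0"
    using E by (auto simp: det_0_iff_vec_prod_zero_field[OF E(1)] mat_kernel[OF E(1)])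
  then obtain F where F: "F \<in> carrier_mat n n" "F * E = 1\<^sub>m n" "E * F = 1\<^sub>m n"
    using det_non_zero_imp_unit[OF E(1), of "()"] by (auto simp: Units_def ring_mat_def)
  \<comment> \<open>\<open>F\<close> sends a vector to its coordinates in the basis formed by the
    columns of \<open>E\<close>. Its last \<open>n - ?d\<close> rows give the coordinates outside
    \<open>C\<close>.\<close>
  define H where "H = mat (n - ?d) n (\<lambda>(i, j). F $$ (i + ?d, j))"
  have H: "H \<in> carrier_mat (n - ?d) n"
    by (simp add: H_def)
  have Hx: "(H *\<^sub>v x) $ i = (F *\<^sub>v x) $ (i + ?d)" if "x \<in> carrier_vec n" "i < n - ?d" for x i
    using that F(1) by (simp add: H_def scalar_prod_def)
  have "x \<in> C" if x: "x \<in> carrier_vec n" and "H *\<^sub>v x = 0\<^sub>v (n - ?d)" for x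
  proof -
    have "(F *\<^sub>v x) $ i = 0" if "?d \<le> i" "i < n" for i
      using Hx[OF x, of "i - ?d"] that \<open>H *\<^sub>v x = 0\<^sub>v (n - ?d)\<close> by simp
    then have "F *\<^sub>v x = vec n (\<lambda>j. if j < ?d then vec ?d (\<lambda>j. (F *\<^sub>v x) $ j) $ j else 0)"
      using F(1) by (intro eq_vecI) auto
    \<comment> \<open>Only the first \<open>?d\<close> columns of \<open>E\<close> contribute, and
      these are the basis of \<open>C\<close>.\<close>
    then have "E *\<^sub>v (F *\<^sub>v x) = A *\<^sub>v vec ?d (\<lambda>j. (F *\<^sub>v x) $ j)"
      using mult_mat_vec_take_cols[OF E(1) d, of "vec ?d (\<lambda>j. (F *\<^sub>v x) $ j)"] AE by simp
    moreover have "E *\<^sub>v (F *\<^sub>v x) = x"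
      using assoc_mult_mat_vec[OF E(1) F(1) x] F(3) x by simp
    ultimately show ?thesis
      using C_image by (metis image_eqI vec_carrier)
  qed
  moreover have "x \<in> carrier_vec n \<and> H *\<^sub>v x = 0\<^sub>v (n - ?d)" if "x \<in> C" for x
  proof -
    from that obtain y where y: "y \<in> carrier_vec ?d" "x = A *\<^sub>v y"
      using C_image by blast
    let ?z = "vec n (\<lambda>j. if j < ?d then y $ j else 0)"
    have x: "x \<in> carrier_vec n"
      using y A(1) by simp
    have "x = E *\<^sub>v ?z"
      using mult_mat_vec_take_cols[OF E(1) d y(1)] AE y(2) by simp
    then have Fx: "F *\<^sub>v x = ?z"
      using assoc_mult_mat_vec[OF F(1) E(1), of ?z] F(2) by simp
    have "H *\<^sub>v x = 0\<^sub>v (n - ?d)"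
      using Hx[OF x] H by (intro eq_vecI) (simp_all add: Fx del: index_mult_mat_vec)
    with x show ?thesis by blast
  qed
  ultimately have "mat_kernel H = C"
    unfolding mat_kernel[OF H] by blast
  with H show ?thesis by blast
qed

text \<open>The first \<open>k\<close> columns of a basis matrix of \<open>W\<close> are still
  independent, so they span a subspace of dimension \<open>k\<close>.\<close>

lemma vec_subspace_subspace_of_dim:
  fixes W :: "'a :: field vec set"
  assumes W: "vec_subspace n W" and k: "k \<le> vec_subspace_dim n W"
  shows "\<exists>U \<subseteq> W. vec_subspace n U \<and> vec_subspace_dim n U = k"
proof -
  let ?d = "vec_subspace_dim n W"
  obtain B where B: "B \<in> carrier_mat n ?d" "mat_kernel B = {0\<^sub>v ?d}" "vec_space.col_space n B = W"
    using vec_subspace_basis_matrix[OF W] .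
  let ?A = "mat n k (\<lambda>(i, j). B $$ (i, j))"
  have A: "?A \<in> carrier_mat n k"
    by simp
  have Ax: "?A *\<^sub>v x = B *\<^sub>v vec ?d (\<lambda>j. if j < k then x $ j else 0)" if "x \<in> carrier_vec k" for x
    using mult_mat_vec_take_cols[OF B(1) k that] .
  have "x = 0\<^sub>v k" if "x \<in> mat_kernel ?A" for x
  proof -
    have x: "x \<in> carrier_vec k"
      using that mat_kernelD(1)[OF A] by blast
    then have "vec ?d (\<lambda>j. if j < k then x $ j else 0) \<in> mat_kernel B"
      using that Ax unfolding mat_kernel[OF A] mat_kernel[OF B(1)] by simp
    then have zero: "vec ?d (\<lambda>j. if j < k then x $ j else 0) = 0\<^sub>v ?d"
      using B(2) by simp
    have "x $ j = 0" if "j < k" for j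
      using arg_cong[OF zero, of "\<lambda>v. v $ j"] that k by simp
    then show ?thesis
      using x by (intro eq_vecI) auto
  qed
  then have "mat_kernel ?A = {0\<^sub>v k}"
    using vec_subspace_mat_kernel[OF A] by (auto simp: vec_subspace_iff)
  then have "vec_subspace_dim n (vec_space.col_space n ?A) = k"
    using mat_kernel_trivial_iff_rank[OF A] by (simp add: vec_subspace_dim_col_space)
  moreover have "vec_space.col_space n ?A \<subseteq> W"
    unfolding col_space_conv_image[OF A] using col_space_conv_image[OF B(1), unfolded B(3)] Ax by auto
  ultimately show ?thesis
    using vec_subspace_col_space[OF A] by blast
qed

section \<open>Block decompositions\<close>

text \<open>The column space lies in a one-dimensional space, so its dimension is at most 1. A
  nonzero entry of \<open>v\<close> is itself a column and excludes dimension 0.\<close>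

lemma rank_mat_of_row:
  fixes v :: "'a :: field vec"
  assumes v: "v \<in> carrier_vec n"
  shows "vec_space.rank 1 (mat_of_row v) = (if v = 0\<^sub>v n then 0 else 1)"
proof (cases "v = 0\<^sub>v n")
  case True
  then have "mat_of_row v = 0\<^sub>m 1 n"
    by (auto simp: mat_of_row_def intro!: eq_matI)
  then show ?thesis
    using True by (simp add: vec_space.rank_0I)
next
  case False
  have A: "mat_of_row v \<in> carrier_mat 1 n"
    using v by simp
  obtain j where j: "j < n" "v $ j \<noteq> 0"
    using False v by (auto simp: vec_eq_iff)
  have "vec_space.col_space 1 (mat_of_row v) \<noteq> {0\<^sub>v 1}"
  proof
    assume "vec_space.col_space 1 (mat_of_row v) = {0\<^sub>v 1}"
    then have "mat_of_row v *\<^sub>v unit_vec n j = 0\<^sub>v 1"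
      unfolding col_space_conv_image[OF A] by (metis image_eqI singletonD unit_vec_carrier)
    then have "(mat_of_row v *\<^sub>v unit_vec n j) $ 0 = 0"
      by simp
    then show False
      using j v by simp
  qed
  then show ?thesis
    using False vec_subspace_dim_le[OF vec_subspace_col_space[OF A]]
      vec_subspace_dim_eq_0_iff[OF vec_subspace_col_space[OF A]]
    by (simp add: vec_subspace_dim_col_space)
qed

lemma vec_block_carrier [simp]: "vec_block N c i \<in> carrier_vec N"
  by (simp add: vec_block_def)

lemma mat_col_block_carrier: "H \<in> carrier_mat r n \<Longrightarrow> mat_col_block N H i \<in> carrier_mat r N"
  by (simp add: mat_col_block_def)

text \<open>Each block is a single row, so its rank only records whether the block is
  nonzero.\<close>

lemma sum_rank_weight_eq_card:
  fixes c :: "'a :: {field, finite} vec"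
  shows "sum_rank_weight ell N c = card {i. i < ell \<and> vec_block N c i \<noteq> 0\<^sub>v N}"
proof -
  have "sum_rank_weight ell N c = (\<Sum>i<ell. if vec_block N c i \<noteq> 0\<^sub>v N then 1 else 0)"
    unfolding sum_rank_weight_def by (intro sum.cong refl) (simp add: rank_mat_of_row[of _ N] del: One_nat_def)
  also have "\<dots> = card {i \<in> {..<ell}. vec_block N c i \<noteq> 0\<^sub>v N}"
    by (simp add: sum.If_cases Int_def)
  finally show ?thesis by simp
qed

section \<open>Assembling vectors and matrices from blocks\<close>

definition vec_of_blocks :: "nat \<Rightarrow> nat \<Rightarrow> (nat \<Rightarrow> 'a vec) \<Rightarrow> 'a vec" where
  "vec_of_blocks ell N f = vec (ell * N) (\<lambda>k. f (k div N) $ (k mod N))"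

definition mat_of_col_blocks :: "nat \<Rightarrow> nat \<Rightarrow> nat \<Rightarrow> (nat \<Rightarrow> 'a mat) \<Rightarrow> 'a mat" where
  "mat_of_col_blocks r ell N M = mat r (ell * N) (\<lambda>(a, k). M (k div N) $$ (a, k mod N))"

lemma block_index_less:
  fixes i j ell N :: nat
  assumes "i < ell" "j < N"
  shows "i * N + j < ell * N"
proof -
  have "i * N + j < Suc i * N"
    using assms(2) by simp
  also have "\<dots> \<le> ell * N"
    using assms(1) by (intro mult_le_mono1) simp
  finally show ?thesis .
qed

lemma vec_of_blocks_carrier: "vec_of_blocks ell N f \<in> carrier_vec (ell * N)"
  by (simp add: vec_of_blocks_def)

lemma vec_block_of_blocks:
  assumes "i < ell" "f i \<in> carrier_vec N"
  shows "vec_block N (vec_of_blocks ell N f) i = f i"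
  using assms by (intro eq_vecI) (auto simp: vec_block_def vec_of_blocks_def block_index_less)

lemma mat_of_col_blocks_carrier: "mat_of_col_blocks r ell N M \<in> carrier_mat r (ell * N)"
  by (simp add: mat_of_col_blocks_def)

lemma mat_col_block_of_col_blocks:
  assumes "i < ell" "M i \<in> carrier_mat r N"
  shows "mat_col_block N (mat_of_col_blocks r ell N M) i = M i"
  using assms by (intro eq_matI) (auto simp: mat_col_block_def mat_of_col_blocks_def block_index_less)

lemma eq_zero_vec_if_blocks_zero:
  fixes c :: "'a :: zero vec"
  assumes c: "c \<in> carrier_vec (ell * N)" and zero: "\<And>i. i < ell \<Longrightarrow> vec_block N c i = 0\<^sub>v N"
  shows "c = 0\<^sub>v (ell * N)"
proof (rule eq_vecI)
  fix k assume "k < dim_vec (0\<^sub>v (ell * N) :: 'a vec)"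
  then have k: "k < ell * N" by simp
  then have "N > 0" by (cases N) auto
  have "k div N < ell"
    using k by (simp add: less_mult_imp_div_less)
  then have "vec_block N c (k div N) $ (k mod N) = 0"
    using zero \<open>N > 0\<close> by simp
  then show "c $ k = 0\<^sub>v (ell * N) $ k"
    using k \<open>N > 0\<close> by (simp add: vec_block_def)
qed (use c in simp)

text \<open>The scalar product with row \<open>a\<close> is a sum over \<open>ell * N\<close>
  positions, which is grouped into \<open>ell\<close> consecutive intervals of length
  \<open>N\<close>.\<close>

lemma mult_mat_vec_blocks:
  fixes H :: "'a :: comm_ring_1 mat"
  assumes H: "H \<in> carrier_mat r (ell * N)" and c: "c \<in> carrier_vec (ell * N)" and a: "a < r"
  shows "(H *\<^sub>v c) $ a = (\<Sum>i<ell. (mat_col_block N H i *\<^sub>v vec_block N c i) $ a)"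
proof -
  have "(mat_col_block N H i *\<^sub>v vec_block N c i) $ a = (\<Sum>k = i * N..<i * N + N. H $$ (a, k) * c $ k)"
    if "i < ell" for i
  proof -
    have "(\<Sum>k = i * N..<i * N + N. H $$ (a, k) * c $ k)
        = (\<Sum>j = 0..<N. H $$ (a, j + i * N) * c $ (j + i * N))"
      using sum.shift_bounds_nat_ivl[of "\<lambda>k. H $$ (a, k) * c $ k" 0 "i * N" N]
      by (simp add: add.commute)
    then show ?thesis
      using H a by (simp add: mat_col_block_def vec_block_def scalar_prod_def add.commute)
  qed
  then have "(\<Sum>i<ell. (mat_col_block N H i *\<^sub>v vec_block N c i) $ a) = (\<Sum>k<ell * N. H $$ (a, k) * c $ k)"
    by (simp add: sum.nat_group)
  then show ?thesis
    using H c a by (simp add: scalar_prod_def atLeast0LessThan)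
qed

section \<open>Sum-rank distance and partial spreads\<close>

text \<open>A lower bound on the infimum is a bound on every nonzero codeword. The zero code
  satisfies it vacuously, in agreement with its infinite distance.\<close>

lemma sum_rank_distance_ge_3_iff:
  fixes C :: "'a :: {field, finite} vec set"
  shows "sum_rank_distance ell N C \<ge> 3 \<longleftrightarrow>
    (\<forall>c\<in>C. card {i. i < ell \<and> vec_block N c i \<noteq> 0\<^sub>v N} \<le> 2 \<longrightarrow> c = 0\<^sub>v (ell * N))"
proof -
  have "(3::enat) \<le> enat w \<longleftrightarrow> \<not> w \<le> 2" for w
    by (auto simp: numeral_eq_enat)
  then show ?thesis
    by (auto simp: sum_rank_distance_def le_INF_iff sum_rank_weight_eq_card)
qed

text \<open>Trivial kernels exclude codewords of weight 1, and trivial intersections then exclude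
  weight 2. The intersections run over pairs of distinct indices, so that two blocks with the same
  column space also count as a pair.\<close>

lemma sum_rank_distance_mat_kernel_ge_3_iff:
  fixes H :: "'a :: {field, finite} mat"
  assumes H: "H \<in> carrier_mat r (ell * N)"
  shows "sum_rank_distance ell N (mat_kernel H) \<ge> 3 \<longleftrightarrow>
    (\<forall>i<ell. mat_kernel (mat_col_block N H i) = {0\<^sub>v N}) \<and>
    (\<forall>i<ell. \<forall>j<ell. i \<noteq> j \<longrightarrow>
      vec_space.col_space r (mat_col_block N H i) \<inter> vec_space.col_space r (mat_col_block N H j) = {0\<^sub>v r})"
    (is "?D \<longleftrightarrow> ?K \<and> ?I")
proof -
  let ?B = "mat_col_block N H"
  note B = mat_col_block_carrier[OF H, of N]
  have zero: "?B i *\<^sub>v 0\<^sub>v N = 0\<^sub>v r" for i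
    using vec_subspace_mat_kernel[OF B] mat_kernelD(2)[OF B] by (auto simp: vec_subspace_iff)
  have uminus: "?B i *\<^sub>v (- y) = - (?B i *\<^sub>v y)" if "y \<in> carrier_vec N" for i y
  proof -
    have "- v = -1 \<cdot>\<^sub>v v" for v :: "'a vec"
      by (intro eq_vecI) auto
    then show ?thesis
      using mult_mat_vec[OF B that, of i "-1"] by metis
  qed
  show ?thesis
  proof (intro iffI conjI allI impI)
    assume D: ?D
    \<comment> \<open>A family of blocks with at most two nonzero members, whose images under the
      blocks of \<open>H\<close> cancel, assembles to a codeword of weight at most 2. By
      \<open>D\<close> it is zero.\<close>
    have blocks_zero: "f i = 0\<^sub>v N"
      if f: "\<And>k. f k \<in> carrier_vec N" and S: "card {k. k < ell \<and> f k \<noteq> 0\<^sub>v N} \<le> 2"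
        and sum: "\<And>a. a < r \<Longrightarrow> (\<Sum>k<ell. (?B k *\<^sub>v f k) $ a) = 0" and i: "i < ell" for f i
    proof -
      let ?c = "vec_of_blocks ell N f"
      have blk: "vec_block N ?c k = f k" if "k < ell" for k
        using vec_block_of_blocks[OF that f] .
      have "H *\<^sub>v ?c = 0\<^sub>v r"
        using mult_mat_vec_blocks[OF H vec_of_blocks_carrier, of _ f] sum H
        by (intro eq_vecI) (simp_all add: blk del: index_mult_mat_vec)
      then have "?c \<in> mat_kernel H"
        by (intro mat_kernelI[OF H vec_of_blocks_carrier])
      moreover have "{k. k < ell \<and> vec_block N ?c k \<noteq> 0\<^sub>v N} = {k. k < ell \<and> f k \<noteq> 0\<^sub>v N}"
        using blk by auto
      ultimately have "?c = 0\<^sub>v (ell * N)"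
        using D S unfolding sum_rank_distance_ge_3_iff by simp
      moreover have "vec_block N (0\<^sub>v (ell * N)) i = (0\<^sub>v N :: 'a vec)"
        using i by (intro eq_vecI) (simp_all add: vec_block_def block_index_less)
      ultimately show ?thesis
        using blk[OF i] by simp
    qed
    show "mat_kernel (?B i) = {0\<^sub>v N}" if i: "i < ell" for i
    proof -
      have "y = 0\<^sub>v N" if "y \<in> mat_kernel (?B i)" for y
      proof -
        note y = mat_kernelD[OF B that]
        let ?f = "\<lambda>k. if k = i then y else 0\<^sub>v N"
        have "{k. k < ell \<and> ?f k \<noteq> 0\<^sub>v N} \<subseteq> {i}"
          by auto
        then have "card {k. k < ell \<and> ?f k \<noteq> 0\<^sub>v N} \<le> card {i}"
          by (intro card_mono) auto
        moreover have "(?B k *\<^sub>v ?f k) $ a = 0" if "a < r" for k a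
          using that y zero by simp
        ultimately show ?thesis
          using blocks_zero[of ?f i] y i by auto
      qed
      then show ?thesis
        using vec_subspace_mat_kernel[OF B] by (auto simp: vec_subspace_iff)
    qed
    show "vec_space.col_space r (?B i) \<inter> vec_space.col_space r (?B j) = {0\<^sub>v r}"
      if i: "i < ell" and j: "j < ell" and ne: "i \<noteq> j" for i j
    proof -
      have "z = 0\<^sub>v r" if z: "z \<in> vec_space.col_space r (?B i)" "z \<in> vec_space.col_space r (?B j)" for z
      proof -
        obtain x y where x: "x \<in> carrier_vec N" "z = ?B i *\<^sub>v x" and y: "y \<in> carrier_vec N" "z = ?B j *\<^sub>v y"
          using z unfolding col_space_conv_image[OF B] by blast
        \<comment> \<open>A common vector \<open>z\<close> of the two column spaces gives two images
          that cancel once \<open>y\<close> changes sign.\<close>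
        let ?f = "\<lambda>k. if k = i then x else if k = j then - y else 0\<^sub>v N"
        have "{k. k < ell \<and> ?f k \<noteq> 0\<^sub>v N} \<subseteq> {i, j}"
          by auto
        then have "card {k. k < ell \<and> ?f k \<noteq> 0\<^sub>v N} \<le> card {i, j}"
          by (intro card_mono) auto
        also have "\<dots> = 2"
          using ne by simp
        finally have card: "card {k. k < ell \<and> ?f k \<noteq> 0\<^sub>v N} \<le> 2" .
        have "(\<Sum>k<ell. (?B k *\<^sub>v ?f k) $ a) = 0" if a: "a < r" for a
        proof -
          have "(\<Sum>k<ell. (?B k *\<^sub>v ?f k) $ a) = (\<Sum>k\<in>{i, j}. (?B k *\<^sub>v ?f k) $ a)"
            using i j a by (intro sum.mono_neutral_right) (auto simp: zero)
          also have "\<dots> = z $ a + (- z) $ a"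
            using ne x(2) y(2) uminus[OF y(1), of j] by simp
          also have "\<dots> = 0"
            using a x(2) B[of i] by simp
          finally show ?thesis .
        qed
        then have "x = 0\<^sub>v N"
          using blocks_zero[of ?f i] card i x(1) y(1) by auto
        then show ?thesis
          using x(2) zero by simp
      qed
      then show ?thesis
        using vec_subspace_col_space[OF B] by (auto simp: vec_subspace_iff)
    qed
  next
    assume KI: "?K \<and> ?I"
    have "c = 0\<^sub>v (ell * N)"
      if c: "c \<in> mat_kernel H" and S: "card {k. k < ell \<and> vec_block N c k \<noteq> 0\<^sub>v N} \<le> 2" for c
    proof (rule ccontr)
      assume "c \<noteq> 0\<^sub>v (ell * N)"
      note cH = mat_kernelD[OF H c]
      obtain i where i: "i < ell" "vec_block N c i \<noteq> 0\<^sub>v N"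
        using eq_zero_vec_if_blocks_zero[OF cH(1)] \<open>c \<noteq> 0\<^sub>v (ell * N)\<close> by blast
      have sum: "(\<Sum>k<ell. (?B k *\<^sub>v vec_block N c k) $ a) = 0" if "a < r" for a
        using mult_mat_vec_blocks[OF H cH(1) that] cH(2) that by simp
      \<comment> \<open>The trivial kernel of block \<open>i\<close> of \<open>H\<close> keeps the
        image of the nonzero block of \<open>c\<close> nonzero.\<close>
      have nz: "?B i *\<^sub>v vec_block N c i \<noteq> 0\<^sub>v r"
        using KI i mat_kernelI[OF B[of i], of "vec_block N c i"] by auto
      let ?S = "{k. k < ell \<and> vec_block N c k \<noteq> 0\<^sub>v N}"
      define T where "T = ?S - {i}"
      have "finite T" "card T \<le> Suc 0"
        using S i by (simp_all add: T_def card_Diff_singleton)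
      then have "\<forall>x\<in>T. \<forall>y\<in>T. x = y"
        by (simp add: card_le_Suc0_iff_eq)
      \<comment> \<open>At most one nonzero block besides \<open>i\<close> remains. If there is
        none, \<open>j\<close> is arbitrary, which is why the cases below ask whether
        \<open>j\<close> is really such a block.\<close>
      then obtain j where "T \<subseteq> {j}"
        by blast
      then have j: "?S - {i} \<subseteq> {j}"
        by (simp only: T_def)
      show False
      proof (cases "j \<in> ?S - {i}")
        case True
        \<comment> \<open>Only blocks \<open>i\<close> and \<open>j\<close> enter the parity checks,
          so their contributions are opposite. This puts a nonzero vector into both column
          spaces.\<close>
        have "?B i *\<^sub>v vec_block N c i = ?B j *\<^sub>v (- vec_block N c j)"
        proof (rule eq_vecI)
          fix a assume "a < dim_vec (?B j *\<^sub>v (- vec_block N c j))"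
          then have a: "a < r"
            using B[of j] by simp
          have "(\<Sum>k<ell. (?B k *\<^sub>v vec_block N c k) $ a) = (\<Sum>k\<in>{i, j}. (?B k *\<^sub>v vec_block N c k) $ a)"
            using i True j a by (intro sum.mono_neutral_right) (auto simp: zero)
          then show "(?B i *\<^sub>v vec_block N c i) $ a = (?B j *\<^sub>v (- vec_block N c j)) $ a"
            using sum[OF a] True a B[of j] B[of i] uminus[of "vec_block N c j" j]
            by (simp add: eq_neg_iff_add_eq_0 del: index_mult_mat_vec)
        qed (use B[of i] B[of j] in simp)
        then have "?B i *\<^sub>v vec_block N c i \<in>
            vec_space.col_space r (?B i) \<inter> vec_space.col_space r (?B j)"
          unfolding col_space_conv_image[OF B]
          by (metis IntI image_eqI uminus_carrier_vec vec_block_carrier)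
        moreover have "vec_space.col_space r (?B i) \<inter> vec_space.col_space r (?B j) = {0\<^sub>v r}"
          using KI i True by auto
        ultimately show False
          using nz by auto
      next
        case False
        \<comment> \<open>With no second nonzero block, the parity checks see block \<open>i\<close>
          alone.\<close>
        have "?B i *\<^sub>v vec_block N c i = 0\<^sub>v r"
        proof (rule eq_vecI)
          fix a assume "a < dim_vec (0\<^sub>v r :: 'a vec)"
          then have a: "a < r" by simp
          have "(\<Sum>k<ell. (?B k *\<^sub>v vec_block N c k) $ a) = (\<Sum>k\<in>{i}. (?B k *\<^sub>v vec_block N c k) $ a)"
            using i False j a by (intro sum.mono_neutral_right) (auto simp: zero)
          then show "(?B i *\<^sub>v vec_block N c i) $ a = 0\<^sub>v r $ a"
            using sum[OF a] a by simp
        qed (use B[of i] in simp)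
        with nz show False by simp
      qed
    qed
    then show ?D
      unfolding sum_rank_distance_ge_3_iff by blast
  qed
qed

text \<open>Passing from indexed column spaces to the set \<open>P\<close> requires distinct indices
  to give distinct members. The condition \<open>card P = ell\<close> records this.\<close>

lemma sum_rank_distance_ge_3_iff_partial_spread:
  fixes H :: "'a :: {field, finite} mat"
  assumes H: "H \<in> carrier_mat r (ell * N)" and N: "N > 0"
  defines "P \<equiv> (\<lambda>i. vec_space.col_space r (mat_col_block N H i)) ` {..<ell}"
  shows "sum_rank_distance ell N (mat_kernel H) \<ge> 3 \<longleftrightarrow> card P = ell \<and> partial_spread N r P"
proof -
  define cs where "cs i = vec_space.col_space r (mat_col_block N H i)" for i
  note B = mat_col_block_carrier[OF H, of N]
  have P: "P = cs ` {..<ell}"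
    by (simp add: P_def cs_def)
  have sub: "vec_subspace r (cs i)" for i
    unfolding cs_def by (rule vec_subspace_col_space[OF B])
  have iff: "sum_rank_distance ell N (mat_kernel H) \<ge> 3 \<longleftrightarrow>
      (\<forall>i<ell. vec_subspace_dim r (cs i) = N) \<and> (\<forall>i<ell. \<forall>j<ell. i \<noteq> j \<longrightarrow> cs i \<inter> cs j = {0\<^sub>v r})"
    unfolding sum_rank_distance_mat_kernel_ge_3_iff[OF H] cs_def
    by (simp add: mat_kernel_trivial_iff_rank[OF B] vec_subspace_dim_col_space)
  show ?thesis
  proof
    assume "sum_rank_distance ell N (mat_kernel H) \<ge> 3"
    with iff have dim: "\<And>i. i < ell \<Longrightarrow> vec_subspace_dim r (cs i) = N"
      and triv: "\<And>i j. i < ell \<Longrightarrow> j < ell \<Longrightarrow> i \<noteq> j \<Longrightarrow> cs i \<inter> cs j = {0\<^sub>v r}"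
      by blast+
    have "inj_on cs {..<ell}"
    \<comment> \<open>Two equal column spaces that meet trivially are both zero, which contradicts
      their dimension \<open>N > 0\<close>.\<close>
    proof (intro inj_onI, rule ccontr)
      fix i j assume ij: "i \<in> {..<ell}" "j \<in> {..<ell}" "cs i = cs j" "i \<noteq> j"
      then have "cs i = {0\<^sub>v r}"
        using triv[of i j] by simp
      then show False
        using dim[of i] ij(1) N by (simp add: vec_subspace_dim_zero)
    qed
    then have "card P = ell"
      by (simp add: P card_image)
    moreover have "U \<inter> W = {0\<^sub>v r}" if UW: "U \<in> P" "W \<in> P" "U \<noteq> W" for U W
      using triv UW unfolding P by blast
    ultimately show "card P = ell \<and> partial_spread N r P"
      unfolding partial_spread_def using sub dim by (auto simp: P)
  next
    assume P_spread: "card P = ell \<and> partial_spread N r P"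
    then have "inj_on cs {..<ell}"
      unfolding P by (intro eq_card_imp_inj_on) auto
    then have "cs i \<noteq> cs j" if "i < ell" "j < ell" "i \<noteq> j" for i j
      using that by (auto dest: inj_onD)
    then have "cs i \<inter> cs j = {0\<^sub>v r}" if "i < ell" "j < ell" "i \<noteq> j" for i j
      using P_spread that by (simp add: P partial_spread_def)
    moreover have "vec_subspace_dim r (cs i) = N" if "i < ell" for i
      using P_spread that by (simp add: P partial_spread_def)
    ultimately show "sum_rank_distance ell N (mat_kernel H) \<ge> 3"
      using iff by blast
  qed
qed

section \<open>From codes to parity-check matrices and from spreads to codes\<close>

lemma redundancy_mat_kernel:
  fixes H :: "'a :: {field, finite} mat"
  assumes "H \<in> carrier_mat r n"
  shows "redundancy n (mat_kernel H) = vec_space.rank r H"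
  using rank_nullity_mat[OF assms] by (simp add: redundancy_def)

text \<open>The matrix has as many rows as the redundancy of its kernel, and by rank-nullity that
  redundancy is its rank. Full row rank is therefore automatic.\<close>

lemma linear_code_parity_check:
  fixes C :: "'a :: {field, finite} vec set"
  assumes C: "linear_code n C"
  shows "\<exists>H. parity_check_matrix n H C"
proof -
  obtain H where H: "H \<in> carrier_mat (redundancy n C) n" "mat_kernel H = C"
    using vec_subspace_parity_check[OF C] by (auto simp: redundancy_def)
  then show ?thesis
    using redundancy_mat_kernel[OF H(1)] by (auto simp: parity_check_matrix_def)
qed

text \<open>The parity-check matrix assembled from the members of \<open>Q\<close> need not have rank \<open>r\<close>.
  Its kernel is then too large, and a subcode of the right dimension is taken instead.\<close>

lemma partial_spread_imp_code:
  fixes Q :: "'a :: {field, finite} vec set set"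
  assumes Q: "partial_spread N r Q" "finite Q" and N: "N > 0" and r: "r \<le> card Q * N"
  shows "\<exists>C :: 'a vec set. linear_code (card Q * N) C \<and> sum_rank_distance (card Q) N C \<ge> 3 \<and>
    redundancy (card Q * N) C = r"
proof -
  let ?k = "card Q"
  obtain f where "bij_betw f {0..<?k} Q"
    using ex_bij_betw_nat_finite[OF Q(2)] by blast
  then have f: "f ` {..<?k} = Q"
    by (simp add: bij_betw_def atLeast0LessThan)
  have "\<exists>B. B \<in> carrier_mat r N \<and> vec_space.col_space r B = f i" if "i < ?k" for i
  proof -
    have "vec_subspace r (f i)" "vec_subspace_dim r (f i) = N"
      using Q(1) f that by (auto simp: partial_spread_def)
    then show ?thesis
      using vec_subspace_basis_matrix by metis
  qed
  then obtain M where M: "\<And>i. i < ?k \<Longrightarrow> M i \<in> carrier_mat r N"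
    "\<And>i. i < ?k \<Longrightarrow> vec_space.col_space r (M i) = f i"
    by metis
  define H where "H = mat_of_col_blocks r ?k N M"
  have H: "H \<in> carrier_mat r (?k * N)"
    unfolding H_def by (rule mat_of_col_blocks_carrier)
  have "vec_space.col_space r (mat_col_block N H i) = f i" if "i < ?k" for i
    using that M by (simp add: H_def mat_col_block_of_col_blocks)
  then have "(\<lambda>i. vec_space.col_space r (mat_col_block N H i)) ` {..<?k} = Q"
    using f by (auto simp: image_def)
  then have D: "sum_rank_distance ?k N (mat_kernel H) \<ge> 3"
    using sum_rank_distance_ge_3_iff_partial_spread[OF H N] Q(1) by simp
  have "vec_space.rank r H \<le> r"
    using vec_subspace_dim_le[OF vec_subspace_col_space[OF H]] by (simp add: vec_subspace_dim_col_space)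
  \<comment> \<open>Each of the at most \<open>r\<close> independent checks costs one dimension, so
    the kernel has room for a subcode of redundancy exactly \<open>r\<close>.\<close>
  then have "?k * N - r \<le> vec_subspace_dim (?k * N) (mat_kernel H)"
    using rank_nullity_mat[OF H] by linarith
  then obtain C where C: "C \<subseteq> mat_kernel H" "linear_code (?k * N) C"
    and dim: "vec_subspace_dim (?k * N) C = ?k * N - r"
    using vec_subspace_subspace_of_dim[OF vec_subspace_mat_kernel[OF H]] by blast
  \<comment> \<open>The distance cannot drop in a subcode.\<close>
  have "sum_rank_distance ?k N C \<ge> 3"
    using D C(1) unfolding sum_rank_distance_ge_3_iff by blast
  \<comment> \<open>The bound \<open>r \<le> ?k * N\<close> makes the truncated subtraction
    exact.\<close>
  moreover have "redundancy (?k * N) C = r"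
    using dim r by (simp add: redundancy_def)
  ultimately show ?thesis
    using C(2) by blast
qed

section \<open>Maximal length against maximal spread size\<close>

theorem theorem3:
  fixes C :: "'a :: {field, finite} vec set" and ell N n r :: nat
  assumes "ell > 0" and "N > 0" and "n = ell * N"
    and "linear_code n C" and "r = redundancy n C"
  shows "proper_sum_rank_Hamming_code ell N C \<longleftrightarrow>
    N \<le> r \<and>
    (\<exists>H :: 'a mat. H \<in> carrier_mat r n \<and> parity_check_matrix n H C \<and>
       (let P = (\<lambda>i. vec_space.col_space r (mat_col_block N H i)) ` {..<ell}
        in card P = ell \<and> maximal_size_partial_spread N r P))"
proof
  assume proper: "proper_sum_rank_Hamming_code ell N C"
  obtain H where pc: "parity_check_matrix n H C"
    using linear_code_parity_check[OF assms(4)] by blast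
  then have H: "H \<in> carrier_mat r (ell * N)" "C = mat_kernel H"
    using assms(3,5) by (auto simp: parity_check_matrix_def)
  define P where "P = (\<lambda>i. vec_space.col_space r (mat_col_block N H i)) ` {..<ell}"
  have "sum_rank_distance ell N (mat_kernel H) \<ge> 3"
    using proper H(2) by (simp add: proper_sum_rank_Hamming_code_def)
  then have P: "card P = ell" "partial_spread N r P"
    using sum_rank_distance_ge_3_iff_partial_spread[OF H(1) assms(2)] by (simp_all add: P_def)
  have "card Q \<le> card P" if Q: "partial_spread N r Q" for Q :: "'a vec set set"
  proof (rule ccontr)
    assume "\<not> card Q \<le> card P"
    then have less: "ell < card Q"
      using P(1) by simp
    \<comment> \<open>An infinite set would have \<open>card\<close> 0, but \<open>card Q\<close>
      exceeds \<open>ell\<close>.\<close>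
    then have "finite Q"
      using card_gt_0_iff by force
    \<comment> \<open>The redundancy never exceeds the length, and the length available to
      \<open>Q\<close> is larger still. This is the size condition for building a code from
      \<open>Q\<close>.\<close>
    have "r \<le> ell * N"
      using assms(3,5) by (simp add: redundancy_def)
    also have "\<dots> \<le> card Q * N"
      using less by simp
    finally show False
      using partial_spread_imp_code[OF Q \<open>finite Q\<close> assms(2)] less proper assms(3,5)
      by (auto simp: proper_sum_rank_Hamming_code_def)
  qed
  with P(2) have "maximal_size_partial_spread N r P"
    by (simp add: maximal_size_partial_spread_def)
  moreover have "N \<le> r"
  proof -
    \<comment> \<open>Since \<open>ell > 0\<close>, the spread has a member, and its dimension
      \<open>N\<close> is at most that of the ambient space.\<close>
    obtain U where "U \<in> P"
      using assms(1) by (auto simp: P_def)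
    then show ?thesis
      using P(2) vec_subspace_dim_le by (metis partial_spread_def)
  qed
  ultimately show "N \<le> r \<and> (\<exists>H :: 'a mat. H \<in> carrier_mat r n \<and> parity_check_matrix n H C \<and>
       (let P = (\<lambda>i. vec_space.col_space r (mat_col_block N H i)) ` {..<ell}
        in card P = ell \<and> maximal_size_partial_spread N r P))"
    using pc H(1) P(1) assms(3) unfolding P_def Let_def by blast
next
  assume "N \<le> r \<and> (\<exists>H :: 'a mat. H \<in> carrier_mat r n \<and> parity_check_matrix n H C \<and>
       (let P = (\<lambda>i. vec_space.col_space r (mat_col_block N H i)) ` {..<ell}
        in card P = ell \<and> maximal_size_partial_spread N r P))"
  then obtain H P where H: "H \<in> carrier_mat r (ell * N)" "C = mat_kernel H"
    and P: "P = (\<lambda>i. vec_space.col_space r (mat_col_block N H i)) ` {..<ell}"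
    and max: "card P = ell" "maximal_size_partial_spread N r P"
    using assms(3) by (auto simp: parity_check_matrix_def Let_def)
  have "sum_rank_distance ell N C \<ge> 3"
    using sum_rank_distance_ge_3_iff_partial_spread[OF H(1) assms(2)] max H(2)
    by (simp add: P maximal_size_partial_spread_def)
  moreover have "ell' \<le> ell"
    if C': "linear_code (ell' * N) C'" "sum_rank_distance ell' N C' \<ge> 3"
      and red: "redundancy (ell' * N) C' = redundancy (ell * N) C" for ell' and C' :: "'a vec set"
  proof -
    \<comment> \<open>Equal redundancy gives \<open>H'\<close> the same number \<open>r\<close> of
      rows, so both spreads live in the same ambient space and their sizes can be compared.\<close>
    obtain H' where H': "H' \<in> carrier_mat r (ell' * N)" "C' = mat_kernel H'"
      using linear_code_parity_check[OF C'(1)] red assms(3,5) by (auto simp: parity_check_matrix_def)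
    let ?P' = "(\<lambda>i. vec_space.col_space r (mat_col_block N H' i)) ` {..<ell'}"
    have "card ?P' = ell'" "partial_spread N r ?P'"
      using sum_rank_distance_ge_3_iff_partial_spread[OF H'(1) assms(2)] C'(2) H'(2) by simp_all
    then show ?thesis
      using max unfolding maximal_size_partial_spread_def by metis
  qed
  ultimately show "proper_sum_rank_Hamming_code ell N C"
    unfolding proper_sum_rank_Hamming_code_def using assms(3,4) by (metis not_le)
qed

end
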